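(* Let $w^\star$ be a stable Nash equilibrium of the $h$-player differentiable game $(f_1,\dots,f_h)$, and let $\eta,\tau>0$. Assume: (i) there exists a convex neighbourhood $\mathcal U\subseteq\Omega$ of $w^\star$ such that the game gradient $F$ is $L_F$-Lipschitz on $\mathcal U$ and, for each $i=1,\dots,h$, the mapping $w\mapsto D(\nabla_{x_i}f_i)(w)$ is $L_i$-Lipschitz on $\mathcal U$; (ii) the frozen map $T^\star_{\eta,\tau}(w):=w-\eta\,(I-\tau A(w^\star))F(w)$ is continuously differentiable on $\mathcal U$ and satisfies $\|DT^\star_{\eta,\tau}(w^\star)\|_2<1$; (iii) $\eta\,\tau\,(h-1)\,L_F<1$. Then there exist constants $R>0$ and $\delta_0>0$ such that $B_R(w^\star)\subseteq\mathcal U$ and, if $$w^0\in B_R(w^\star),\qquad \|M_i^0-D(\nabla_{x_i}f_i)(w^\star)\|_2\le\delta_0,\quad i=1,\dots,h,$$ then the sequence $(w^k)_{k\ge 0}$ generated by the MultiLRSGA method with parameters $\eta,\tau$ and initial data $w^0, M_1^0,\dots,M_h^0$ converges linearly to $w^\star$. More precisely, there exist constants $C>0$ and $q\in(0,1)$ such that $$\|w^k-w^\star\|_2\le C q^k,\qquad k\ge 0.$$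
   Context: Game setting. Let $h\ge 2$, $d_1,\dots,d_h\ge1$, $d=\sum_{i=1}^h d_i$. Let $S_i\subset\mathbb R^{d_i}$ be nonempty, convex and compact, and let $\Omega\subset\mathbb R^d$ be open and convex with $S_1\times\cdots\times S_h\subset\Omega$. Player $i$ has objective $f_i\in C^3(\Omega,\mathbb R)$, and $w=(x_1,\dots,x_h)\in\mathbb R^d$ with $x_i\in\mathbb R^{d_i}$. A Nash equilibrium is a point $w^\star=(x_1^\star,\dots,x_h^\star)\in S_1\times\cdots\times S_h$ such that, for every $i$ and every $x_i\in S_i$, $f_i(w^\star)\le f_i(x_1^\star,\dots,x_{i-1}^\star,x_i,x_{i+1}^\star,\dots,x_h^\star)$. The game gradient is $F(w)=(\nabla_{x_1}f_1(w)^\top,\dots,\nabla_{x_h}f_h(w)^\top)^\top\in\mathbb R^d$. The game Hessian is $H(w)=DF(w)=(H_{ij}(w))_{i,j=1}^h$ with $H_{ij}(w)=\nabla^2_{x_ix_j}f_i(w)\in\mathbb R^{d_i\times d_j}$; $S(w)=\tfrac12(H(w)+H(w)^\top)$ and $A(w)=\tfrac12(H(w)-H(w)^\top)$ are its symmetric and antisymmetric parts. $D(\nabla_{x_i}f_i)(w)\in\mathbb R^{d_i\times d}$ is the Jacobian of $\nabla_{x_i}f_i$ with respect to the whole variable $w$. A stable Nash equilibrium $w^\star$ is a Nash equilibrium with $F(w^\star)=0$, $H(w^\star)$ invertible and $S(w^\star)$ positive semidefinite. Norms. $\|\cdot\|_2$ is the Euclidean norm on vectors and the induced spectral norm on matrices;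 Lipschitz constants refer to these norms. $B_R(w^\star)$ is the ball of radius $R$ centred at $w^\star$. MultiLRSGA method. Given $\eta,\tau>0$, $w^0$ and matrices $M_i^0\in\mathbb R^{d_i\times d}$, $i=1,\dots,h$, write $M_i^k=([M_i^k]_1,\dots,[M_i^k]_h)$ by block columns, $[M_i^k]_j\in\mathbb R^{d_i\times d_j}$. Define the block matrix $\widehat A_k\in\mathbb R^{d\times d}$ by $(\widehat A_k)_{ii}=0$ and $(\widehat A_k)_{ij}=\tfrac12([M_i^k]_j-[M_j^k]_i^\top)$ for $i\ne j$. The iteration is $$w^{k+1}=w^k-\eta(I-\tau\widehat A_k)F(w^k),$$ $$M_i^{k+1}=M_i^k+\frac{\big(\nabla_{x_i}f_i(w^{k+1})-\nabla_{x_i}f_i(w^k)-M_i^k(w^{k+1}-w^k)\big)(w^{k+1}-w^k)^\top}{\|w^{k+1}-w^k\|_2^2},\quad i=1,\dots,h,$$ with $M_i^{k+1}:=M_i^k$ if $w^{k+1}=w^k$. *)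

theory Defs
  imports "HOL-Analysis.Analysis"
begin

text \<open>
  Encoding of the product space. The coordinates of the joint strategy space are indexed by a finite
  type \<open>'n\<close> and the players by a finite type \<open>'p\<close>; a surjection \<open>pl :: 'n \<Rightarrow> 'p\<close> assigns to each
  coordinate its owner. Hence \<open>h = CARD('p)\<close>, \<open>d = CARD('n)\<close> and
  \<open>d\<^sub>i = card {a. pl a = i} \<ge> 1\<close>, and the joint space is \<open>real ^ 'n\<close>.
  The space of player \<open>i\<close> is identified isometrically with the subspace \<open>block_space pl i\<close> of vectors
  supported on the coordinates of \<open>i\<close>, and a \<open>d\<^sub>i \<times> d\<close> matrix with the \<open>d \<times> d\<close> matrix obtained by
  padding with zero rows (\<open>block_rows pl i\<close>); the padding leaves the spectral norm unchanged.
\<close>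

definition block_space :: "('n::finite \<Rightarrow> 'p) \<Rightarrow> 'p \<Rightarrow> (real ^ 'n) set" where
  "block_space pl i = {x. \<forall>a. pl a \<noteq> i \<longrightarrow> x $ a = 0}"

definition block_rows :: "('n::finite \<Rightarrow> 'p) \<Rightarrow> 'p \<Rightarrow> (real ^ 'n ^ 'n) set" where
  "block_rows pl i = {M. \<forall>a b. pl a \<noteq> i \<longrightarrow> M $ a $ b = 0}"

definition block :: "('n::finite \<Rightarrow> 'p) \<Rightarrow> 'p \<Rightarrow> real ^ 'n \<Rightarrow> real ^ 'n" where
  "block pl i w = (\<chi> a. if pl a = i then w $ a else 0)"

definition strategy_product ::
    "('n::finite \<Rightarrow> 'p) \<Rightarrow> ('p \<Rightarrow> (real ^ 'n) set) \<Rightarrow> (real ^ 'n) set" where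
  "strategy_product pl S = {w. \<forall>i. block pl i w \<in> S i}"

definition replace_block ::
    "('n::finite \<Rightarrow> 'p) \<Rightarrow> 'p \<Rightarrow> real ^ 'n \<Rightarrow> real ^ 'n \<Rightarrow> real ^ 'n" where
  "replace_block pl i x w = (\<chi> a. if pl a = i then x $ a else w $ a)"

text \<open>
  For open \<open>X\<close> in finite dimension, \<open>Ck_on k f X\<close> is the usual class \<open>C\<^sup>k(X)\<close>, defined by iterated
  directional derivatives. Derivatives are taken in the ambient space, so \<open>f\<close> must be defined
  around \<open>X\<close> when \<open>X\<close> is not open.
\<close>

primrec Ck_on ::
    "nat \<Rightarrow> ('a::real_normed_vector \<Rightarrow> 'b::real_normed_vector) \<Rightarrow> 'a set \<Rightarrow> bool" where
  "Ck_on 0 f X \<longleftrightarrow> continuous_on X f"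
| "Ck_on (Suc k) f X \<longleftrightarrow>
     (\<forall>x\<in>X. f differentiable (at x)) \<and>
     (\<forall>v. Ck_on k (\<lambda>x. frechet_derivative f (at x) v) X)"

definition spectral_norm :: "real ^ 'n ^ 'm \<Rightarrow> real" where
  "spectral_norm M = onorm ((*v) M)"

definition spectral_lipschitz_on ::
    "real \<Rightarrow> 'a::metric_space set \<Rightarrow> ('a \<Rightarrow> real ^ 'n ^ 'm) \<Rightarrow> bool" where
  "spectral_lipschitz_on L X J \<longleftrightarrow>
     0 \<le> L \<and> (\<forall>x\<in>X. \<forall>y\<in>X. spectral_norm (J x - J y) \<le> L * dist x y)"

definition pos_semidef :: "real ^ 'n ^ 'n \<Rightarrow> bool" where
  "pos_semidef M \<longleftrightarrow> transpose M = M \<and> (\<forall>x. 0 \<le> x \<bullet> (M *v x))"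

definition grad :: "(real ^ 'n \<Rightarrow> real) \<Rightarrow> real ^ 'n \<Rightarrow> real ^ 'n" where
  "grad g w = (\<chi> a. frechet_derivative g (at w) (axis a 1))"

text \<open>\<open>own_grad pl f i\<close> is the partial gradient \<open>\<nabla>\<^bsub>x\<^sub>i\<^esub> f\<^sub>i\<close>, embedded in the joint space.\<close>

definition own_grad ::
    "('n::finite \<Rightarrow> 'p) \<Rightarrow> ('p \<Rightarrow> real ^ 'n \<Rightarrow> real) \<Rightarrow> 'p \<Rightarrow> real ^ 'n \<Rightarrow> real ^ 'n" where
  "own_grad pl f i w = block pl i (grad (f i) w)"

text \<open>Stacking the blocks \<open>\<nabla>\<^bsub>x\<^sub>i\<^esub> f\<^sub>i\<close>: coordinate \<open>a\<close> comes from the objective of its owner.\<close>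

definition game_grad ::
    "('n::finite \<Rightarrow> 'p) \<Rightarrow> ('p \<Rightarrow> real ^ 'n \<Rightarrow> real) \<Rightarrow> real ^ 'n \<Rightarrow> real ^ 'n" where
  "game_grad pl f w = (\<chi> a. own_grad pl f (pl a) w $ a)"

definition game_hess ::
    "('n::finite \<Rightarrow> 'p) \<Rightarrow> ('p \<Rightarrow> real ^ 'n \<Rightarrow> real) \<Rightarrow> real ^ 'n \<Rightarrow> real ^ 'n ^ 'n" where
  "game_hess pl f w = jacobian (game_grad pl f) (at w)"

definition sym_part :: "real ^ 'n ^ 'n \<Rightarrow> real ^ 'n ^ 'n" where
  "sym_part M = (1/2) *\<^sub>R (M + transpose M)"

definition antisym_part :: "real ^ 'n ^ 'n \<Rightarrow> real ^ 'n ^ 'n" where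
  "antisym_part M = (1/2) *\<^sub>R (M - transpose M)"

definition nash_equilibrium ::
    "('n::finite \<Rightarrow> 'p) \<Rightarrow> ('p \<Rightarrow> (real ^ 'n) set) \<Rightarrow> ('p \<Rightarrow> real ^ 'n \<Rightarrow> real)
      \<Rightarrow> real ^ 'n \<Rightarrow> bool" where
  "nash_equilibrium pl S f w \<longleftrightarrow>
     w \<in> strategy_product pl S \<and>
     (\<forall>i. \<forall>x\<in>S i. f i w \<le> f i (replace_block pl i x w))"

definition stable_nash_equilibrium ::
    "('n::finite \<Rightarrow> 'p) \<Rightarrow> ('p \<Rightarrow> (real ^ 'n) set) \<Rightarrow> ('p \<Rightarrow> real ^ 'n \<Rightarrow> real)
      \<Rightarrow> real ^ 'n \<Rightarrow> bool" where
  "stable_nash_equilibrium pl S f w \<longleftrightarrow>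
     nash_equilibrium pl S f w \<and>
     game_grad pl f w = 0 \<and>
     invertible (game_hess pl f w) \<and>
     pos_semidef (sym_part (game_hess pl f w))"

definition frozen_map ::
    "('n::finite \<Rightarrow> 'p) \<Rightarrow> ('p \<Rightarrow> real ^ 'n \<Rightarrow> real) \<Rightarrow> real \<Rightarrow> real \<Rightarrow> real ^ 'n
      \<Rightarrow> real ^ 'n \<Rightarrow> real ^ 'n" where
  "frozen_map pl f \<eta> \<tau> wstar w =
     w - \<eta> *\<^sub>R ((mat 1 - \<tau> *\<^sub>R antisym_part (game_hess pl f wstar)) *v game_grad pl f w)"

text \<open>
  Entrywise form of the block definition: for \<open>a\<close> owned by \<open>i\<close> and \<open>b\<close> owned by \<open>j \<noteq> i\<close>, the
  \<open>(a, b)\<close> entry of \<open>([M\<^sub>i]\<^sub>j - [M\<^sub>j]\<^sub>i\<^sup>T) / 2\<close> is computed below.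
\<close>

definition A_hat :: "('n::finite \<Rightarrow> 'p) \<Rightarrow> ('p \<Rightarrow> real ^ 'n ^ 'n) \<Rightarrow> real ^ 'n ^ 'n" where
  "A_hat pl M = (\<chi> a b. if pl a = pl b then 0
                        else (1/2) * (M (pl a) $ a $ b - M (pl b) $ b $ a))"

definition outer :: "real ^ 'm \<Rightarrow> real ^ 'n \<Rightarrow> real ^ 'n ^ 'm" where
  "outer u v = (\<chi> a b. u $ a * v $ b)"

definition broyden_update ::
    "real ^ 'n ^ 'm \<Rightarrow> real ^ 'n \<Rightarrow> real ^ 'm \<Rightarrow> real ^ 'n ^ 'm" where
  "broyden_update M s y =
     (if s = 0 then M else M + (1 / (norm s)\<^sup>2) *\<^sub>R outer (y - M *v s) s)"

definition lrsga_step ::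
    "('n::finite \<Rightarrow> 'p) \<Rightarrow> ('p \<Rightarrow> real ^ 'n \<Rightarrow> real) \<Rightarrow> real \<Rightarrow> real
      \<Rightarrow> (real ^ 'n) \<times> ('p \<Rightarrow> real ^ 'n ^ 'n) \<Rightarrow> (real ^ 'n) \<times> ('p \<Rightarrow> real ^ 'n ^ 'n)" where
  "lrsga_step pl f \<eta> \<tau> = (\<lambda>(w, M).
     let w' = w - \<eta> *\<^sub>R ((mat 1 - \<tau> *\<^sub>R A_hat pl M) *v game_grad pl f w)
     in (w', \<lambda>i. broyden_update (M i) (w' - w) (own_grad pl f i w' - own_grad pl f i w)))"

definition lrsga_iterate ::
    "('n::finite \<Rightarrow> 'p) \<Rightarrow> ('p \<Rightarrow> real ^ 'n \<Rightarrow> real) \<Rightarrow> real \<Rightarrow> real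
      \<Rightarrow> real ^ 'n \<Rightarrow> ('p \<Rightarrow> real ^ 'n ^ 'n) \<Rightarrow> nat \<Rightarrow> real ^ 'n" where
  "lrsga_iterate pl f \<eta> \<tau> w0 M0 k = fst ((lrsga_step pl f \<eta> \<tau> ^^ k) (w0, M0))"

end

theory Submission
  imports Defs
begin

text \<open>
  Near \<open>wstar\<close> the frozen map contracts distances to \<open>wstar\<close> by a factor \<open>\<rho> < 1\<close>, and one step of the
  method differs from it by \<open>\<eta> \<tau> (A_hat M - A(wstar)) F(w)\<close>, of norm \<open>O(\<delta> \<parallel>w - wstar\<parallel>)\<close> when all
  \<open>M i\<close> are \<open>\<delta>\<close>-close to the Jacobians at \<open>wstar\<close>. For small \<open>\<delta>\<close> a step therefore contracts by some
  fixed \<open>q < 1\<close>. By bounded deterioration of the Broyden update the Jacobian errors grow at most by a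
  multiple of \<open>\<parallel>w\<^sup>k - wstar\<parallel> \<le> R q\<^sup>k\<close> per step, hence by \<open>O(R / (1 - q))\<close> in total, and stay below \<open>\<delta>\<close>
  if the initial errors and \<open>R\<close> are small.
\<close>

section \<open>Symmetry of second derivatives\<close>

text \<open>Schwarz's theorem for two fixed directions. The second-order hypotheses concern only the
  directional derivatives along \<open>u\<close> and \<open>v\<close>, so the iterated directional
  derivatives in \<open>Ck_on\<close> supply them directly.\<close>

lemma symmetric_second_derivative:
  fixes f :: "'a::real_normed_vector \<Rightarrow> real"
  assumes "open X" "w \<in> X"
    and f: "\<And>x. x \<in> X \<Longrightarrow> (f has_derivative f' x) (at x)"
    and fu: "\<And>x. x \<in> X \<Longrightarrow> ((\<lambda>y. f' y u) has_derivative gu x) (at x)"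
    and fv: "\<And>x. x \<in> X \<Longrightarrow> ((\<lambda>y. f' y v) has_derivative gv x) (at x)"
    and "continuous_on X (\<lambda>x. gu x v)" "continuous_on X (\<lambda>x. gv x u)"
  shows "gu w v = gv w u"
proof -
  \<comment> \<open>The second difference is symmetric in \<open>a\<close> and \<open>b\<close>; the mean value theorem, first along \<open>a\<close>
    and then along \<open>b\<close>, turns it into a mixed derivative near \<open>w\<close>.\<close>
  have mean: "\<exists>p. dist p w \<le> t * (norm a + norm b) \<and>
      f (w + t *\<^sub>R a + t *\<^sub>R b) - f (w + t *\<^sub>R a) - f (w + t *\<^sub>R b) + f w = t * (t * ga p b)"
    if t: "0 < t" "cball w (t * (norm a + norm b)) \<subseteq> X"
      and fa: "\<And>x. x \<in> X \<Longrightarrow> ((\<lambda>y. f' y a) has_derivative ga x) (at x)" for t a b ga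
  proof -
    \<comment> \<open>The whole parallelogram spanned by \<open>t a\<close> and \<open>t b\<close>
      at \<open>w\<close> stays in \<open>X\<close>, which makes both uses of the mean value theorem
      legitimate.\<close>
    have inX: "w + r *\<^sub>R a + s *\<^sub>R b \<in> X" if "0 \<le> r" "r \<le> t" "0 \<le> s" "s \<le> t" for r s
    proof -
      have "norm (r *\<^sub>R a + s *\<^sub>R b) \<le> r * norm a + s * norm b"
        using that by (metis abs_of_nonneg norm_scaleR norm_triangle_ineq)
      also have "\<dots> \<le> t * (norm a + norm b)"
        using that by (auto simp: distrib_left intro!: add_mono mult_right_mono)
      finally show ?thesis
        using t by (auto simp: dist_norm add.assoc subset_iff norm_minus_commute)
    qed
    \<comment> \<open>The terms with factor \<open>0\<close> keep the difference of the values at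
      \<open>t\<close> and \<open>0\<close> in the shape in which \<open>MVT2\<close>
      concludes.\<close>
    have "\<exists>z>0. z < t \<and>
        (f (w + t *\<^sub>R a + t *\<^sub>R b) - f (w + t *\<^sub>R a)) - (f (w + 0 *\<^sub>R a + t *\<^sub>R b) - f (w + 0 *\<^sub>R a))
        = (t - 0) * (f' (w + z *\<^sub>R a + t *\<^sub>R b) a - f' (w + z *\<^sub>R a) a)"
    proof (rule MVT2)
      fix r assume r: "0 \<le> r" "r \<le> t"
      have 1: "w + r *\<^sub>R a + t *\<^sub>R b \<in> X" using inX[of r t] r t by simp
      have 2: "w + r *\<^sub>R a \<in> X" using inX[of r 0] r t by simp
      have "((\<lambda>r. f (w + r *\<^sub>R a + t *\<^sub>R b) - f (w + r *\<^sub>R a)) has_derivative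
          (\<lambda>s. f' (w + r *\<^sub>R a + t *\<^sub>R b) (s *\<^sub>R a) - f' (w + r *\<^sub>R a) (s *\<^sub>R a))) (at r)"
        by (rule derivative_eq_intros has_derivative_compose[OF _ f] 1 2 refl | simp)+
      then show "((\<lambda>r. f (w + r *\<^sub>R a + t *\<^sub>R b) - f (w + r *\<^sub>R a)) has_real_derivative
          f' (w + r *\<^sub>R a + t *\<^sub>R b) a - f' (w + r *\<^sub>R a) a) (at r)"
        by (rule has_derivative_imp_has_field_derivative)
          (simp add: right_diff_distrib linear_scale[OF has_derivative_linear[OF f[OF 1]]]
            linear_scale[OF has_derivative_linear[OF f[OF 2]]])
    qed (use t in auto)
    then obtain z where z: "0 < z" "z < t" and
      e1: "f (w + t *\<^sub>R a + t *\<^sub>R b) - f (w + t *\<^sub>R a) - f (w + t *\<^sub>R b) + f w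
        = t * (f' (w + z *\<^sub>R a + t *\<^sub>R b) a - f' (w + z *\<^sub>R a) a)"
      by auto
    have "\<exists>y>0. y < t \<and> f' (w + z *\<^sub>R a + t *\<^sub>R b) a - f' (w + z *\<^sub>R a + 0 *\<^sub>R b) a
        = (t - 0) * ga (w + z *\<^sub>R a + y *\<^sub>R b) b"
    proof (rule MVT2)
      fix r assume r: "0 \<le> r" "r \<le> t"
      have 1: "w + z *\<^sub>R a + r *\<^sub>R b \<in> X" using inX[of z r] r z by simp
      have "((\<lambda>r. f' (w + z *\<^sub>R a + r *\<^sub>R b) a) has_derivative
          (\<lambda>s. ga (w + z *\<^sub>R a + r *\<^sub>R b) (s *\<^sub>R b))) (at r)"
        by (rule derivative_eq_intros has_derivative_compose[OF _ fa] 1 refl | simp)+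
      then show "((\<lambda>r. f' (w + z *\<^sub>R a + r *\<^sub>R b) a) has_real_derivative
          ga (w + z *\<^sub>R a + r *\<^sub>R b) b) (at r)"
        using linear_scale[OF has_derivative_linear[OF fa[OF 1]]]
        by (simp add: has_field_derivative_def mult_commute_abs)
    qed (use t in auto)
    then obtain y where y: "0 < y" "y < t" and
      e2: "f' (w + z *\<^sub>R a + t *\<^sub>R b) a - f' (w + z *\<^sub>R a) a = t * ga (w + z *\<^sub>R a + y *\<^sub>R b) b"
      by auto
    have "norm (z *\<^sub>R a + y *\<^sub>R b) \<le> z * norm a + y * norm b"
      using y z by (metis abs_of_nonneg less_imp_le norm_scaleR norm_triangle_ineq)
    also have "\<dots> \<le> t * (norm a + norm b)"
      using y z by (auto simp: distrib_left intro!: add_mono mult_right_mono)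
    finally have "dist (w + z *\<^sub>R a + y *\<^sub>R b) w \<le> t * (norm a + norm b)"
      by (simp add: dist_norm add.assoc)
    then show ?thesis using e1 e2 by auto
  qed
  \<comment> \<open>The summand \<open>0\<close> gives the form that \<open>field_le_epsilon\<close>
    expects.\<close>
  have "dist (gu w v) (gv w u) \<le> 0 + e" if "0 < e" for e
  proof -
    have "isCont (\<lambda>x. gu x v) w" "isCont (\<lambda>x. gv x u) w"
      using assms by (auto simp: continuous_on_eq_continuous_at)
    then obtain d1 d2 where d: "d1 > 0" "d2 > 0"
      "\<And>x. dist x w < d1 \<Longrightarrow> dist (gu x v) (gu w v) < e/2"
      "\<And>x. dist x w < d2 \<Longrightarrow> dist (gv x u) (gv w u) < e/2"
      using \<open>0 < e\<close> unfolding continuous_at_eps_delta by (metis half_gt_zero)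
    obtain d3 where d3: "d3 > 0" "cball w d3 \<subseteq> X"
      using assms(1,2) open_contains_cball by blast
    \<comment> \<open>The mean value points are only known to lie within the non-strict distance
      \<open>m\<close> of \<open>w\<close>; halving makes \<open>m\<close> strictly smaller than
      \<open>d1\<close> and \<open>d2\<close>.\<close>
    define m where "m = min d3 (min d1 d2 / 2)"
    have m: "0 < m" "m < d1" "m < d2" "m \<le> d3" using d d3 by (auto simp: m_def)
    \<comment> \<open>The added 1 keeps the denominator positive when \<open>u\<close> and
      \<open>v\<close> both vanish.\<close>
    define t where "t = m / (norm u + norm v + 1)"
    have pos: "0 < norm u + norm v + 1"
      by (simp add: add_nonneg_pos)
    have t: "0 < t" using m pos by (simp add: t_def)
    have "t * (norm u + norm v) \<le> t * (norm u + norm v + 1)" using t by simp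
    also have "\<dots> = m" using pos by (simp add: t_def)
    finally have tm: "t * (norm u + norm v) \<le> m" .
    have sub: "cball w (t * (norm u + norm v)) \<subseteq> X" "cball w (t * (norm v + norm u)) \<subseteq> X"
      using d3 tm m by (auto simp: subset_iff add.commute)
    obtain p where p: "dist p w \<le> t * (norm u + norm v)"
      "f (w + t *\<^sub>R u + t *\<^sub>R v) - f (w + t *\<^sub>R u) - f (w + t *\<^sub>R v) + f w = t * (t * gu p v)"
      using mean[OF t sub(1) fu] by blast
    obtain p' where p': "dist p' w \<le> t * (norm v + norm u)"
      "f (w + t *\<^sub>R v + t *\<^sub>R u) - f (w + t *\<^sub>R v) - f (w + t *\<^sub>R u) + f w = t * (t * gv p' u)"
      using mean[OF t sub(2) fv] by blast
    have "t * (t * gu p v) = t * (t * gv p' u)"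
      using p(2) p'(2) by (simp add: algebra_simps)
    then have "gu p v = gv p' u" using t by simp
    moreover have "dist (gu p v) (gu w v) < e/2" "dist (gv p' u) (gv w u) < e/2"
      using d p p' tm m by (auto simp: add.commute)
    ultimately show ?thesis unfolding dist_real_def by linarith
  qed
  then have "dist (gu w v) (gv w u) \<le> 0" by (rule field_le_epsilon)
  then show ?thesis by simp
qed

text \<open>\<open>Ck_on\<close> states continuity only at its last level. Differentiability
  recovers it in the base case, and the directional derivatives carry it upwards, which is why the
  induction is over all \<open>f\<close>.\<close>

lemma Ck_on_Suc_imp: "Ck_on (Suc k) f X \<Longrightarrow> Ck_on k f X"
proof (induction k arbitrary: f)
  case 0
  then show ?case
    by (simp add: continuous_at_imp_continuous_on differentiable_imp_continuous_within)
next
  case (Suc k)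
  then show ?case
    unfolding Ck_on.simps(2)[of "Suc k"] Ck_on.simps(2)[of k] by blast
qed

lemma second_frechet_derivative_commute:
  fixes f :: "'a::real_normed_vector \<Rightarrow> real"
  assumes "open X" "w \<in> X" "Ck_on 2 f X"
  shows "frechet_derivative (\<lambda>x. frechet_derivative f (at x) u) (at w) v =
    frechet_derivative (\<lambda>x. frechet_derivative f (at x) v) (at w) u"
proof -
  have D1: "(f has_derivative frechet_derivative f (at x)) (at x)" if "x \<in> X" for x
    using assms(3) that by (simp add: numeral_2_eq_2 frechet_derivative_works[symmetric])
  have D2: "((\<lambda>y. frechet_derivative f (at y) z) has_derivative
      frechet_derivative (\<lambda>x. frechet_derivative f (at x) z) (at x)) (at x)" if "x \<in> X" for x z
    using assms(3) that by (simp add: numeral_2_eq_2 frechet_derivative_works[symmetric])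
  show ?thesis
    by (rule symmetric_second_derivative[where f' = "\<lambda>x. frechet_derivative f (at x)",
          OF assms(1,2) D1 D2 D2])
      (use assms(3) in \<open>simp_all add: numeral_2_eq_2\<close>)
qed

section \<open>Jacobians of the partial gradients and the game Hessian\<close>

lemma has_derivative_vec_componentwise:
  fixes f :: "'a::real_normed_vector \<Rightarrow> real ^ 'n"
  assumes "\<And>a. ((\<lambda>x. f x $ a) has_derivative (\<lambda>h. f' h $ a)) (at x within S)"
  shows "(f has_derivative f') (at x within S)"
  unfolding has_derivative_componentwise_within[of f]
  using assms by (auto simp: Basis_vec_def inner_axis)

lemma jacobian_eq_matrix: "(f has_derivative f') (at x) \<Longrightarrow> jacobian f (at x) = matrix f'"
  by (simp add: jacobian_def frechet_derivative_at[symmetric])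

lemma own_grad_has_derivative:
  assumes "Ck_on 2 (f i) X" "w \<in> X"
  shows "(own_grad pl f i has_derivative (\<lambda>h. \<chi> a. if pl a = i
      then frechet_derivative (\<lambda>x. frechet_derivative (f i) (at x) (axis a 1)) (at w) h else 0))
    (at w)"
proof (rule has_derivative_vec_componentwise)
  fix a
  have "((\<lambda>x. frechet_derivative (f i) (at x) (axis a 1)) has_derivative
      frechet_derivative (\<lambda>x. frechet_derivative (f i) (at x) (axis a 1)) (at w)) (at w)"
    using assms by (simp add: numeral_2_eq_2 frechet_derivative_works[symmetric])
  then show "((\<lambda>w. own_grad pl f i w $ a) has_derivative (\<lambda>h. (\<chi> a. if pl a = i
      then frechet_derivative (\<lambda>x. frechet_derivative (f i) (at x) (axis a 1)) (at w) h
      else 0) $ a)) (at w)"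
    by (cases "pl a = i") (simp_all add: own_grad_def block_def grad_def)
qed

lemma own_grad_has_derivative_jacobian:
  assumes "Ck_on 2 (f i) X" "w \<in> X"
  shows "(own_grad pl f i has_derivative (*v) (jacobian (own_grad pl f i) (at w))) (at w)"
  using own_grad_has_derivative[where f = f and i = i and pl = pl, OF assms] jacobian_works
  unfolding differentiable_def by blast

lemma jacobian_own_grad_component:
  assumes "Ck_on 2 (f i) X" "w \<in> X"
  shows "jacobian (own_grad pl f i) (at w) $ a $ b = (if pl a = i
    then frechet_derivative (\<lambda>x. frechet_derivative (f i) (at x) (axis a 1)) (at w) (axis b 1)
    else 0)"
  using jacobian_eq_matrix[OF own_grad_has_derivative[where f = f and i = i and pl = pl, OF assms]]
  by (simp add: matrix_def)

text \<open>Each coordinate of the game gradient comes from the partial gradient of its owner, so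
  the rows of the Hessian are rows of the Jacobians that the matrices \<open>M i\<close>
  approximate.\<close>

lemma game_hess_component:
  assumes "\<And>i. Ck_on 2 (f i) X" "w \<in> X"
  shows "game_hess pl f w $ a $ b = jacobian (own_grad pl f (pl a)) (at w) $ a $ b"
proof -
  have "(game_grad pl f has_derivative
      (\<lambda>h. \<chi> a. (jacobian (own_grad pl f (pl a)) (at w) *v h) $ a)) (at w)"
  proof (rule has_derivative_vec_componentwise)
    fix a
    show "((\<lambda>x. game_grad pl f x $ a) has_derivative
        (\<lambda>h. (\<chi> a. (jacobian (own_grad pl f (pl a)) (at w) *v h) $ a) $ a)) (at w)"
      using bounded_linear.has_derivative[OF bounded_linear_vec_nth
          own_grad_has_derivative_jacobian[where f = f and i = "pl a" and pl = pl, OF assms], of a]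
      by (simp add: game_grad_def)
  qed
  from jacobian_eq_matrix[OF this] show ?thesis
    by (simp add: game_hess_def matrix_def matrix_vector_mult_basis column_def)
qed

text \<open>Symmetry of second derivatives kills the diagonal blocks of the antisymmetric part.\<close>

lemma antisym_part_game_hess:
  assumes "open X" "w \<in> X" "\<And>i. Ck_on 2 (f i) X"
  shows "antisym_part (game_hess pl f w) = A_hat pl (\<lambda>i. jacobian (own_grad pl f i) (at w))"
proof -
  have hess: "game_hess pl f w $ a $ b = jacobian (own_grad pl f (pl a)) (at w) $ a $ b" for a b
    by (rule game_hess_component[where f = f, OF assms(3,2)])
  have "game_hess pl f w $ a $ b = game_hess pl f w $ b $ a" if "pl a = pl b" for a b
    using second_frechet_derivative_commute[OF assms(1,2) assms(3)[of "pl b"],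
        of "axis a 1" "axis b 1"] that
    by (simp add: hess jacobian_own_grad_component[where f = f, OF assms(3,2)])
  moreover note hess
  ultimately show ?thesis
    by (fastforce simp: vec_eq_iff antisym_part_def A_hat_def transpose_def)
qed

section \<open>Spectral norm estimates\<close>

lemma spectral_norm_nonneg: "0 \<le> spectral_norm (M :: real ^ 'n ^ 'm)"
  unfolding spectral_norm_def by (simp add: onorm_pos_le)

lemma norm_matrix_vector_le: "norm (M *v x) \<le> spectral_norm (M :: real ^ 'n ^ 'm) * norm x"
  unfolding spectral_norm_def by (simp add: onorm)

text \<open>An off-diagonal-block entry of \<open>A_hat\<close> is half the difference of two matrix
  entries, so every entry is off by at most \<open>e\<close>. The crude dimension factor is
  harmless, since the tolerance in the convergence proof is chosen to absorb it.\<close>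

lemma spectral_norm_A_hat_diff_le:
  fixes M N :: "'p \<Rightarrow> real ^ 'n ^ 'n"
  assumes "\<And>i. spectral_norm (M i - N i) \<le> e"
  shows "spectral_norm (A_hat pl M - A_hat pl N) \<le> real CARD('n) * real CARD('n) * e"
  unfolding spectral_norm_def
proof (rule onorm_le_matrix_component)
  have *: "\<bar>M i $ a $ b - N i $ a $ b\<bar> \<le> e" for i a b
    using matrix_component_le_onorm[of "M i - N i" a b] assms[of i]
    by (simp add: spectral_norm_def)
  have "0 \<le> e"
    using order_trans[OF spectral_norm_nonneg assms] .
  then show "\<bar>(A_hat pl M - A_hat pl N) $ a $ b\<bar> \<le> e" for a b
    using *[of "pl a" a b] *[of "pl b" b a] by (auto simp: A_hat_def abs_le_iff field_simps)
qed

section \<open>Broyden update and secant error\<close>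

lemma outer_matrix_vector: "outer u v *v x = (v \<bullet> x) *\<^sub>R u"
  by (simp add: vec_eq_iff outer_def matrix_vector_mult_def inner_vec_def sum_distrib_left
      mult_ac)

text \<open>Bounded deterioration: the update composes the error with the orthogonal projection along
  \<open>s\<close>, which does not increase the spectral norm, and adds a rank-one term of norm at most \<open>c\<close>.\<close>

lemma broyden_update_deterioration:
  fixes M J :: "real ^ 'n ^ 'm"
  assumes "norm (y - J *v s) \<le> c * norm s" "0 \<le> c"
  shows "spectral_norm (broyden_update M s y - J) \<le> spectral_norm (M - J) + c"
proof (cases "s = 0")
  case False
  show ?thesis
    unfolding spectral_norm_def[of "broyden_update M s y - J"]
  proof (rule onorm_le)
    fix x
    define t where "t = (s \<bullet> x) / (norm s)\<^sup>2"
    have "orthogonal (t *\<^sub>R s) (x - t *\<^sub>R s)"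
      using False by (simp add: orthogonal_def t_def inner_diff_right power2_norm_eq_inner)
    from norm_add_Pythagorean[OF this]
    have "(norm (x - t *\<^sub>R s))\<^sup>2 \<le> (norm x)\<^sup>2" by simp
    then have proj: "norm (x - t *\<^sub>R s) \<le> norm x"
      by (rule power2_le_imp_le) simp
    have "\<bar>t\<bar> * norm s \<le> norm x"
      using Cauchy_Schwarz_ineq2[of s x] False
      by (simp add: t_def power2_eq_square field_simps)
    then have "c * (\<bar>t\<bar> * norm s) \<le> c * norm x"
      using assms(2) by (rule mult_left_mono)
    moreover have "\<bar>t\<bar> * norm (y - J *v s) \<le> \<bar>t\<bar> * (c * norm s)"
      using assms(1) by (rule mult_left_mono) simp
    ultimately have rank1: "norm (t *\<^sub>R (y - J *v s)) \<le> c * norm x"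
      by (simp add: mult_ac)
    have "(broyden_update M s y - J) *v x = (M - J) *v (x - t *\<^sub>R s) + t *\<^sub>R (y - J *v s)"
      using False
      by (simp add: broyden_update_def t_def matrix_vector_mult_diff_rdistrib
          matrix_vector_mult_add_rdistrib matrix_vector_mult_diff_distrib
          scaleR_matrix_vector_assoc[symmetric] outer_matrix_vector matrix_vector_mult_scaleR
          scaleR_diff_right)
    also have "norm \<dots> \<le> norm ((M - J) *v (x - t *\<^sub>R s)) + norm (t *\<^sub>R (y - J *v s))"
      by (rule norm_triangle_ineq)
    also have "\<dots> \<le> spectral_norm (M - J) * norm (x - t *\<^sub>R s) + c * norm x"
      by (intro add_mono norm_matrix_vector_le rank1)
    also have "\<dots> \<le> spectral_norm (M - J) * norm x + c * norm x"
      by (intro add_mono mult_left_mono proj spectral_norm_nonneg order_refl)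
    finally show "norm ((broyden_update M s y - J) *v x)
        \<le> (spectral_norm (M - J) + c) * norm x"
      by (simp add: distrib_right)
  qed
qed (use assms in \<open>simp add: broyden_update_def\<close>)

text \<open>Mean value inequality for \<open>g z - J c *v z\<close>, whose derivative
  \<open>J z - J c\<close> has norm at most \<open>L * r\<close> on the ball. This yields the
  residual bound that \<open>broyden_update_deterioration\<close> requires.\<close>

lemma secant_error_le:
  fixes g :: "real ^ 'n \<Rightarrow> real ^ 'm"
  assumes g: "\<And>z. z \<in> cball c r \<Longrightarrow> (g has_derivative (*v) (J z)) (at z)"
    and lip: "spectral_lipschitz_on L (cball c r) J"
    and xy: "x \<in> cball c r" "y \<in> cball c r"
  shows "norm (g y - g x - J c *v (y - x)) \<le> L * r * norm (y - x)"
proof -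
  \<comment> \<open>This puts the centre \<open>c\<close> itself in the ball, so that the Lipschitz
    bound may compare \<open>J z\<close> with \<open>J c\<close>.\<close>
  have "0 \<le> r" using xy by (auto intro: order_trans[OF zero_le_dist])
  have "norm ((g y - J c *v y) - (g x - J c *v x)) \<le> L * r * norm (y - x)"
  proof (rule differentiable_bound[OF convex_cball[of c r]])
    fix z assume z: "z \<in> cball c r"
    show "((\<lambda>z. g z - J c *v z) has_derivative (\<lambda>h. J z *v h - J c *v h)) (at z within cball c r)"
      by (rule has_derivative_diff[OF has_derivative_at_withinI[OF g[OF z]]
            bounded_linear_imp_has_derivative[OF matrix_vector_mul_bounded_linear]])
    have "spectral_norm (J z - J c) \<le> L * dist z c"
      using lip z \<open>0 \<le> r\<close> by (simp add: spectral_lipschitz_on_def)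
    also have "\<dots> \<le> L * r"
      using lip z by (intro mult_left_mono) (auto simp: spectral_lipschitz_on_def dist_commute)
    finally show "onorm (\<lambda>h. J z *v h - J c *v h) \<le> L * r"
      by (simp add: spectral_norm_def matrix_vector_mult_diff_rdistrib[symmetric])
  qed (use xy in auto)
  then show ?thesis by (simp add: matrix_vector_mult_diff_distrib algebra_simps)
qed

section \<open>Local linear convergence of the iteration\<close>

theorem theorem1:
  fixes pl :: "'n::finite \<Rightarrow> 'p::finite"
    and S :: "'p \<Rightarrow> (real ^ 'n) set"
    and \<Omega> U :: "(real ^ 'n) set"
    and f :: "'p \<Rightarrow> real ^ 'n \<Rightarrow> real"
    and wstar :: "real ^ 'n"
    and \<eta> \<tau> L\<^sub>F :: real
    and L :: "'p \<Rightarrow> real"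
  assumes players: "CARD('p) \<ge> 2" "surj pl"
    and strategies: "\<And>i. S i \<subseteq> block_space pl i" "\<And>i. S i \<noteq> {}"
          "\<And>i. convex (S i)" "\<And>i. compact (S i)"
    and domain: "open \<Omega>" "convex \<Omega>" "strategy_product pl S \<subseteq> \<Omega>"
    and smooth: "\<And>i. Ck_on 3 (f i) \<Omega>"
    and stable: "stable_nash_equilibrium pl S f wstar"
    and params: "\<eta> > 0" "\<tau> > 0"
    and nbhd: "convex U" "wstar \<in> interior U" "U \<subseteq> \<Omega>"
    and lip_F: "L\<^sub>F-lipschitz_on U (game_grad pl f)"
    and lip_J: "\<And>i. spectral_lipschitz_on (L i) U (\<lambda>w. jacobian (own_grad pl f i) (at w))"
    and frozen: "Ck_on 1 (frozen_map pl f \<eta> \<tau> wstar) U"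
          "spectral_norm (jacobian (frozen_map pl f \<eta> \<tau> wstar) (at wstar)) < 1"
    and small: "\<eta> * \<tau> * (real CARD('p) - 1) * L\<^sub>F < 1"
  shows "\<exists>R>0. \<exists>\<delta>\<^sub>0>0. ball wstar R \<subseteq> U \<and>
    (\<forall>w0 M0. w0 \<in> ball wstar R \<longrightarrow>
       (\<forall>i. M0 i \<in> block_rows pl i \<and>
            spectral_norm (M0 i - jacobian (own_grad pl f i) (at wstar)) \<le> \<delta>\<^sub>0) \<longrightarrow>
       (\<forall>k. lrsga_iterate pl f \<eta> \<tau> w0 M0 k \<in> \<Omega>) \<and>
       (\<exists>C>0. \<exists>q. 0 < q \<and> q < 1 \<and>
          (\<forall>k. norm (lrsga_iterate pl f \<eta> \<tau> w0 M0 k - wstar) \<le> C * q ^ k)))"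
proof -
  let ?F = "game_grad pl f" and ?T = "frozen_map pl f \<eta> \<tau> wstar"
  define J where "J i w = jacobian (own_grad pl f i) (at w)" for i w
  \<comment> \<open>Errors are always measured against the Jacobian at \<open>wstar\<close>, not at
    the current iterate, so that successive errors are directly comparable.\<close>
  define E where "E N i = spectral_norm (N i - J i wstar)" for N i
  have C2: "Ck_on 2 (f i) \<Omega>" for i
    using Ck_on_Suc_imp[of 2 "f i" \<Omega>] smooth[of i] by simp
  have "wstar \<in> U" using nbhd(2) interior_subset by blast
  then have "wstar \<in> \<Omega>" using nbhd(3) by blast
  have Astar: "antisym_part (game_hess pl f wstar) = A_hat pl (\<lambda>i. J i wstar)"
    using antisym_part_game_hess[where f = f and pl = pl, OF domain(1) \<open>wstar \<in> \<Omega>\<close> C2]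
    by (simp add: J_def)
  have F0: "?F wstar = 0" using stable by (simp add: stable_nash_equilibrium_def)
  have LF: "0 \<le> L\<^sub>F" using lip_F by (rule lipschitz_on_nonneg)
  have F_le: "norm (?F w) \<le> L\<^sub>F * norm (w - wstar)" if "w \<in> U" for w
    using lipschitz_onD[OF lip_F that \<open>wstar \<in> U\<close>] F0 by (simp add: dist_norm)

  define LL where "LL = (\<Sum>i\<in>UNIV. L i)"
  have L0: "0 \<le> L i" for i using lip_J[of i] by (simp add: spectral_lipschitz_on_def)
  then have LL: "L i \<le> LL" "0 \<le> LL" for i
    by (auto simp: LL_def intro: member_le_sum sum_nonneg)

  obtain \<rho> where \<rho>: "spectral_norm (jacobian ?T (at wstar)) < \<rho>" "\<rho> < 1"
    using frozen(2) dense by blast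
  have "0 \<le> \<rho>" using \<rho>(1) spectral_norm_nonneg[of "jacobian ?T (at wstar)"] by linarith
  have "?T differentiable (at wstar)"
    using frozen(1) \<open>wstar \<in> U\<close> by simp
  then have T': "(?T has_derivative (*v) (jacobian ?T (at wstar))) (at wstar)"
    by (simp add: jacobian_works)
  have T0: "?T wstar = wstar" by (simp add: frozen_map_def F0)
  obtain r1 where r1: "0 < r1" "\<And>w. norm (w - wstar) < r1 \<Longrightarrow>
      norm (?T w - wstar) \<le> \<rho> * norm (w - wstar)"
  proof -
    obtain d where d: "0 < d" "\<And>w. norm (w - wstar) < d \<Longrightarrow>
        norm (?T w - ?T wstar - jacobian ?T (at wstar) *v (w - wstar))
          \<le> (\<rho> - spectral_norm (jacobian ?T (at wstar))) * norm (w - wstar)"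
      using T' \<rho>(1) unfolding has_derivative_at_alt by (metis diff_gt_0_iff_gt)
    show thesis
    proof (rule that[OF d(1)])
      fix w assume w: "norm (w - wstar) < d"
      show "norm (?T w - wstar) \<le> \<rho> * norm (w - wstar)"
        using d(2)[OF w] norm_matrix_vector_le[of "jacobian ?T (at wstar)" "w - wstar"]
          norm_triangle_sub[of "?T w - wstar" "jacobian ?T (at wstar) *v (w - wstar)"]
        by (simp add: T0 left_diff_distrib)
    qed
  qed

  \<comment> \<open>The midpoint of \<open>\<rho>\<close> and 1: the gap \<open>q - \<rho>\<close>
    is the budget for the error of \<open>A_hat\<close>.\<close>
  define q where "q = (1 + \<rho>) / 2"
  have q: "0 < q" "q < 1" "\<rho> < q" using \<rho> \<open>0 \<le> \<rho>\<close> by (auto simp: q_def)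
  define n2 where "n2 = real CARD('n) * real CARD('n)"
  have n2: "0 \<le> n2" by (simp add: n2_def)
  \<comment> \<open>Chosen so that the perturbation factor fits into \<open>q - \<rho>\<close>; the
    added 1 covers \<open>L\<^sub>F = 0\<close>.\<close>
  define \<delta> where "\<delta> = (q - \<rho>) / (\<eta> * \<tau> * n2 * L\<^sub>F + 1)"
  have den: "0 < \<eta> * \<tau> * n2 * L\<^sub>F + 1"
    using params n2 LF by (simp add: add_nonneg_pos)
  have \<delta>: "0 < \<delta>" using den q by (simp add: \<delta>_def)
  have "\<eta> * \<tau> * n2 * L\<^sub>F * \<delta> \<le> (\<eta> * \<tau> * n2 * L\<^sub>F + 1) * \<delta>" using \<delta> by (simp add: distrib_right)
  also have "\<dots> = q - \<rho>" using den by (simp add: \<delta>_def)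
  finally have \<delta>q: "\<eta> * \<tau> * n2 * L\<^sub>F * \<delta> \<le> q - \<rho>" .

  obtain r2 where r2: "0 < r2" "ball wstar r2 \<subseteq> U"
    using nbhd(2) mem_interior by blast
  \<comment> \<open>Chosen so that the total deterioration, a geometric series with sum at most
    \<open>LL * R / (1 - q)\<close>, uses at most half of \<open>\<delta>\<close>.\<close>
  define r3 where "r3 = \<delta> * (1 - q) / (2 * (LL + 1))"
  have r3: "0 < r3" using \<delta> q LL(2) by (simp add: r3_def)
  define R where "R = min r1 (min r2 r3)"
  have R: "0 < R" "R \<le> r1" "R \<le> r2" "R \<le> r3" using r1 r2 r3 by (auto simp: R_def)
  have "LL * R \<le> (LL + 1) * r3" using R LL(2) by (intro mult_mono) auto
  also have "\<dots> = \<delta> / 2 * (1 - q)"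
    using LL(2) by (simp add: r3_def field_simps)
  finally have LLR: "LL * R / (1 - q) \<le> \<delta> / 2"
    using q by (simp add: field_simps)
  have ball_U: "ball wstar R \<subseteq> U" using r2 R by (auto simp: subset_iff)

  have step: "norm (w' - wstar) \<le> q * norm (w - wstar) \<and>
      (\<forall>i. E M' i \<le> E M i + LL * norm (w - wstar))"
    if w: "norm (w - wstar) < R" and M: "\<And>i. E M i \<le> \<delta>"
      and st: "lrsga_step pl f \<eta> \<tau> (w, M) = (w', M')" for w w' M M'
  proof -
    have wU: "w \<in> U" using ball_U w by (auto simp: dist_norm norm_minus_commute)
    have w': "w' = w - \<eta> *\<^sub>R ((mat 1 - \<tau> *\<^sub>R A_hat pl M) *v ?F w)"
      and M': "M' i = broyden_update (M i) (w' - w) (own_grad pl f i w' - own_grad pl f i w)" for i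
      using st by (auto simp: lrsga_step_def Let_def)
    define B where "B = A_hat pl M - A_hat pl (\<lambda>i. J i wstar)"
    \<comment> \<open>The two minus signs in front of \<open>\<eta>\<close> and
      \<open>\<tau>\<close> cancel, so the error of \<open>A_hat\<close> enters with a plus.\<close>
    have eq: "w' - wstar = (?T w - wstar) + (\<eta> * \<tau>) *\<^sub>R (B *v ?F w)"
      unfolding w' B_def frozen_map_def Astar
      by (simp add: matrix_vector_mult_diff_rdistrib scaleR_matrix_vector_assoc[symmetric]
          scaleR_diff_right)
    have B: "spectral_norm B \<le> n2 * \<delta>"
      unfolding B_def n2_def using M by (intro spectral_norm_A_hat_diff_le) (simp add: E_def)
    have "norm (B *v ?F w) \<le> spectral_norm B * norm (?F w)"
      by (rule norm_matrix_vector_le)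
    also have "\<dots> \<le> (n2 * \<delta>) * (L\<^sub>F * norm (w - wstar))"
      using B F_le[OF wU] n2 \<delta> by (intro mult_mono) auto
    finally have "norm ((\<eta> * \<tau>) *\<^sub>R (B *v ?F w))
        \<le> (\<eta> * \<tau>) * ((n2 * \<delta>) * (L\<^sub>F * norm (w - wstar)))"
      using params by (simp add: mult_left_mono)
    also have "\<dots> = (\<eta> * \<tau> * n2 * L\<^sub>F * \<delta>) * norm (w - wstar)" by simp
    also have "\<dots> \<le> (q - \<rho>) * norm (w - wstar)"
      using \<delta>q by (rule mult_right_mono) simp
    finally have "norm ((\<eta> * \<tau>) *\<^sub>R (B *v ?F w)) \<le> (q - \<rho>) * norm (w - wstar)" .
    moreover have "norm (?T w - wstar) \<le> \<rho> * norm (w - wstar)"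
      using w R by (intro r1(2)) simp
    ultimately have e': "norm (w' - wstar) \<le> q * norm (w - wstar)"
      unfolding eq
      using norm_triangle_ineq[of "?T w - wstar" "(\<eta> * \<tau>) *\<^sub>R (B *v ?F w)"]
      by (simp add: left_diff_distrib)
    also have "\<dots> \<le> norm (w - wstar)"
      using q by (simp add: mult_left_le_one_le)
    finally have le: "norm (w' - wstar) \<le> norm (w - wstar)" .
    \<comment> \<open>By contraction, \<open>w\<close> and \<open>w'\<close> both lie in this ball
      around \<open>wstar\<close>, so the secant error can be estimated on it with radius
      \<open>norm (w - wstar)\<close>.\<close>
    have cball_U: "cball wstar (norm (w - wstar)) \<subseteq> U"
      using ball_U w by (auto simp: subset_iff)
    have "E M' i \<le> E M i + LL * norm (w - wstar)" for i
      unfolding E_def M'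
    proof (rule broyden_update_deterioration)
      have "norm (own_grad pl f i w' - own_grad pl f i w - J i wstar *v (w' - w))
          \<le> L i * norm (w - wstar) * norm (w' - w)"
      proof (rule secant_error_le)
        fix z assume "z \<in> cball wstar (norm (w - wstar))"
        then have "z \<in> \<Omega>" using cball_U nbhd(3) by blast
        then show "(own_grad pl f i has_derivative (*v) (J i z)) (at z)"
          unfolding J_def by (rule own_grad_has_derivative_jacobian[where f = f, OF C2])
      next
        show "spectral_lipschitz_on (L i) (cball wstar (norm (w - wstar))) (J i)"
          using lip_J[of i] cball_U unfolding spectral_lipschitz_on_def J_def by blast
      qed (use le in \<open>auto simp: dist_norm norm_minus_commute\<close>)
      also have "\<dots> \<le> LL * norm (w - wstar) * norm (w' - w)"
        by (intro mult_right_mono LL) auto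
      finally show "norm (own_grad pl f i w' - own_grad pl f i w - J i wstar *v (w' - w))
          \<le> LL * norm (w - wstar) * norm (w' - w)" .
    qed (use LL in simp)
    with e' show ?thesis by blast
  qed

  \<comment> \<open>The strict bound is kept separately because the geometric one gives only
    \<open>\<le> R\<close> at \<open>k = 0\<close>, while the ball is open. The initial errors take
    half of \<open>\<delta>\<close> and leave the other half to deterioration.\<close>
  have main: "norm (lrsga_iterate pl f \<eta> \<tau> w0 M0 k - wstar) \<le> R * q ^ k \<and>
      norm (lrsga_iterate pl f \<eta> \<tau> w0 M0 k - wstar) < R"
    if w0: "w0 \<in> ball wstar R" and M0: "\<And>i. E M0 i \<le> \<delta> / 2" for w0 M0 k
  proof -
    define st where "st k = (lrsga_step pl f \<eta> \<tau> ^^ k) (w0, M0)" for k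
    have st_Suc: "st (Suc k) = lrsga_step pl f \<eta> \<tau> (st k)" for k by (simp add: st_def)
    have geom: "(\<Sum>j<k. q ^ j) \<le> 1 / (1 - q)" for k
      using q sum_le_suminf[of "\<lambda>j. q ^ j" "{..<k}"] by (simp add: suminf_geometric)
    have E_bound: "\<delta> / 2 + LL * R * (\<Sum>j<k. q ^ j) \<le> \<delta>" for k
    proof -
      have "LL * R * (\<Sum>j<k. q ^ j) \<le> LL * R / (1 - q)"
        using mult_left_mono[OF geom[of k], of "LL * R"] LL(2) R(1) by simp
      with LLR show ?thesis by linarith
    qed
    \<comment> \<open>Keeping the partial sum makes the invariant inductive: a step adds at most
      \<open>LL * R * q ^ k\<close>, exactly the next term. Bounding the errors by
      \<open>\<delta>\<close> alone would not be preserved.\<close>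
    have "norm (fst (st k) - wstar) \<le> R * q ^ k \<and> norm (fst (st k) - wstar) < R \<and>
        (\<forall>i. E (snd (st k)) i \<le> \<delta> / 2 + LL * R * (\<Sum>j<k. q ^ j))"
    proof (induction k)
      case 0
      then show ?case
        using w0 M0 by (simp add: st_def dist_norm norm_minus_commute)
    next
      case (Suc k)
      obtain w M where wM: "st k = (w, M)" by fastforce
      obtain w' M' where wM': "st (Suc k) = (w', M')" by fastforce
      have IH: "norm (w - wstar) \<le> R * q ^ k" "norm (w - wstar) < R"
        "E M i \<le> \<delta> / 2 + LL * R * (\<Sum>j<k. q ^ j)" for i
        using Suc wM by auto
      have s: "norm (w' - wstar) \<le> q * norm (w - wstar)"
        "E M' i \<le> E M i + LL * norm (w - wstar)" for i
        using step[OF IH(2) order_trans[OF IH(3) E_bound], of w' M'] st_Suc[of k] wM wM' by auto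
      have "q * norm (w - wstar) \<le> norm (w - wstar)"
        using q by (simp add: mult_left_le_one_le)
      moreover have "q * norm (w - wstar) \<le> q * (R * q ^ k)"
        using IH(1) q by simp
      moreover have "LL * norm (w - wstar) \<le> LL * (R * q ^ k)"
        using IH(1) LL(2) by (rule mult_left_mono)
      then have "E M' i \<le> \<delta> / 2 + LL * R * (\<Sum>j<Suc k. q ^ j)" for i
        using s(2)[of i] IH(3)[of i] by (simp add: distrib_left)
      ultimately show ?case
        using s(1) IH(2) wM' by (auto simp: mult_ac)
    qed
    then show ?thesis by (simp add: lrsga_iterate_def st_def)
  qed
  \<comment> \<open>The witnesses are \<open>C = R\<close> and the fixed \<open>q\<close>, the same
    for all admissible initial data; \<open>\<delta> / 2\<close> serves as
    \<open>\<delta>\<^sub>0\<close>.\<close>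
  have "(\<forall>k. lrsga_iterate pl f \<eta> \<tau> w0 M0 k \<in> \<Omega>) \<and>
      (\<exists>C>0. \<exists>q. 0 < q \<and> q < 1 \<and>
        (\<forall>k. norm (lrsga_iterate pl f \<eta> \<tau> w0 M0 k - wstar) \<le> C * q ^ k))"
    if w0: "w0 \<in> ball wstar R" and M0: "\<forall>i. M0 i \<in> block_rows pl i \<and>
        spectral_norm (M0 i - jacobian (own_grad pl f i) (at wstar)) \<le> \<delta> / 2" for w0 M0
  proof -
    have *: "E M0 i \<le> \<delta> / 2" for i using M0 by (simp add: E_def J_def)
    have "lrsga_iterate pl f \<eta> \<tau> w0 M0 k \<in> \<Omega>" for k
      using main[OF w0 *, of k] ball_U nbhd(3)
      by (auto simp: subset_iff dist_norm norm_minus_commute)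
    then show ?thesis
      using main[OF w0 *] R(1) q(1,2) by blast
  qed
  moreover have "0 < \<delta> / 2" using \<delta> by simp
  ultimately show ?thesis
    using R(1) ball_U by blast
qed

end
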